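(* Let $K\in\mathbb{R}^{n\times n}$ be a symmetric positive definite matrix with eigendecomposition $K=\sum_{\ell=1}^n\lambda_\ell \bm{v}_\ell\bm{v}_\ell^\top$, where $\lambda_1\ge\dots\ge\lambda_n$ and $\bm{v}_1,\dots,\bm{v}_n$ is an orthonormal basis of eigenvectors. Let $1\le k\le n$ be an integer and let $\mathcal{C}\sim kDPP(K)$. Then $$\mathbb{E}_{C}\big[C K_{\mathcal{C}\mathcal{C}}^{-1}C^\top\big] = \sum_{\ell=1}^{n} \frac{\bm{v}_\ell \bm{v}_\ell^\top}{\lambda_\ell +\dfrac{e_{k}(\bm{\lambda}_{\hat{\ell}})}{e_{k-1}(\bm{\lambda}_{\hat{\ell}})}},$$ where $\bm{\lambda}_{\hat{\ell}}\in\mathbb{R}^{n-1}$ is the vector $\bm{\lambda}=(\lambda_1,\dots,\lambda_n)$ with the entry $\lambda_\ell$ removed.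
   Context: Write $[n]=\{1,\dots,n\}$. For a subset $\mathcal{C}\subseteq[n]$, $C$ denotes the $n\times|\mathcal{C}|$ sampling matrix obtained by selecting the columns of the $n\times n$ identity matrix indexed by $\mathcal{C}$, and $K_{\mathcal{C}\mathcal{C}}=C^\top K C$ is the corresponding principal submatrix. For a vector $\bm{\mu}\in\mathbb{R}^m$, $e_k(\bm{\mu})=\sum_{1\le i_1<\dots<i_k\le m}\mu_{i_1}\cdots\mu_{i_k}$ is the $k$-th elementary symmetric polynomial, with $e_0=1$ and $e_k(\bm{\mu})=0$ for $k>m$. For the matrix $K$ with vector of eigenvalues $\bm{\lambda}$, $e_k(K)=e_k(\bm{\lambda})$. $kDPP(K)$ is the probability distribution on subsets $\mathcal{C}\subseteq[n]$ of fixed size $|\mathcal{C}|=k$ given by $\Pr(Y=\mathcal{C})=\det(K_{\mathcal{C}\mathcal{C}})/e_k(K)$. The expectation $\mathbb{E}_C$ is over the random subset $\mathcal{C}$ (equivalently, over its sampling matrix $C$). *)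

theory Defs
  imports
    "HOL-Probability.Probability_Mass_Function"
    "HOL-Computational_Algebra.Polynomial"
    "Jordan_Normal_Form.Matrix"
    "Jordan_Normal_Form.Determinant"
    "Jordan_Normal_Form.Char_Poly"
    "Jordan_Normal_Form.Gauss_Jordan_Elimination"
    "Jordan_Normal_Form.DL_Submatrix"
begin

unbundle no vec_syntax
no_notation inner (infix \<open>\<bullet>\<close> 70)

definition positive_definite :: "nat \<Rightarrow> real mat \<Rightarrow> bool" where
  "positive_definite n K \<longleftrightarrow> K \<in> carrier_mat n n \<and> transpose_mat K = K \<and>
     (\<forall>x \<in> carrier_vec n. x \<noteq> 0\<^sub>v n \<longrightarrow> x \<bullet> (K *\<^sub>v x) > 0)"

(* Matrix types carry no global zero, so the type-class sum is not available for them. *)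
definition mat_sum :: "nat \<Rightarrow> nat \<Rightarrow> ('b \<Rightarrow> real mat) \<Rightarrow> 'b set \<Rightarrow> real mat" where
  "mat_sum nr nc f I = mat nr nc (\<lambda>(i, j). \<Sum>l\<in>I. f l $$ (i, j))"

definition mat_expectation :: "nat \<Rightarrow> nat \<Rightarrow> 'b pmf \<Rightarrow> ('b \<Rightarrow> real mat) \<Rightarrow> real mat" where
  "mat_expectation nr nc p f = mat nr nc (\<lambda>(i, j). measure_pmf.expectation p (\<lambda>x. f x $$ (i, j)))"

definition outer_prod :: "real vec \<Rightarrow> real vec \<Rightarrow> real mat" where
  "outer_prod v w = mat (dim_vec v) (dim_vec w) (\<lambda>(i, j). v $ i * w $ j)"

(* Strictly increasing index tuples of length k are the k-element index sets. *)
definition elem_sym :: "nat \<Rightarrow> real vec \<Rightarrow> real" where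
  "elem_sym k \<mu> = (\<Sum>S | S \<subseteq> {0..<dim_vec \<mu>} \<and> card S = k. \<Prod>i\<in>S. \<mu> $ i)"

definition remove_entry :: "nat \<Rightarrow> real vec \<Rightarrow> real vec" where
  "remove_entry l \<mu> = vec (dim_vec \<mu> - 1) (\<lambda>i. \<mu> $ insert_index l i)"

(* The real roots of the characteristic polynomial with multiplicity, in decreasing order.
   For a symmetric matrix these are all of its eigenvalues. *)
definition eigenvalue_vec :: "real mat \<Rightarrow> real vec" where
  "eigenvalue_vec K = vec_of_list (rev (sorted_list_of_multiset (proots (char_poly K))))"

definition elem_sym_mat :: "nat \<Rightarrow> real mat \<Rightarrow> real" where
  "elem_sym_mat k K = elem_sym k (eigenvalue_vec K)"

(* The n x |S| matrix of the columns of the identity indexed by S, in increasing order. *)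
definition sampling_mat :: "nat \<Rightarrow> nat set \<Rightarrow> real mat" where
  "sampling_mat n S = submatrix (1\<^sub>m n) UNIV S"

definition principal_submat :: "real mat \<Rightarrow> nat set \<Rightarrow> real mat" where
  "principal_submat K S =
     transpose_mat (sampling_mat (dim_row K) S) * K * sampling_mat (dim_row K) S"

(* For positive definite K and k at most its dimension, these weights are nonnegative and sum
   to 1, because the sum of the k x k principal minors of K is elem_sym_mat k K. Otherwise
   embed_pmf may yield an unspecified distribution. *)
definition kDPP :: "nat \<Rightarrow> real mat \<Rightarrow> nat set pmf" where
  "kDPP k K = embed_pmf (\<lambda>S. if S \<subseteq> {0..<dim_row K} \<and> card S = k
     then det (principal_submat K S) / elem_sym_mat k K else 0)"

end

theory Submission
  imports Defs
begin

text \<open>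
  Write A(x) for the adjugate of x I + K. Its (a, b) entry is the determinant of x I + K with
  row b replaced by the unit vector e_a. Expanding that determinant along the diagonal
  perturbation x I gives the sum, over the sets S containing b, of x^(n - |S|) times the minor on
  S of K with the same row replaced; and that minor is det K_SS times the (a, b) entry of the
  zero-padded inverse of K_SS. The weights det K_SS of the k-DPP thus cancel the denominators of
  the inverses, and the expectation times e_k(K) is the coefficient of x^(n - k) in A(x).
  In the eigenbasis, A(x) is the sum over l of v_l v_l^T times the product of the x + lam_m with
  m \<noteq> l, so the coefficient of v_l v_l^T is e_(k-1) of the other eigenvalues. The recursion
  e_k(lam) = lam_l e_(k-1) + e_k, with e_(k-1) and e_k on the right taken over the other
  eigenvalues, turns the quotient by e_k(K) into the stated form.
\<close>

subsection \<open>Minors and diagonal perturbations\<close>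

lemma det_mat_eq_sum_permutes:
  "det (mat n n (\<lambda>(i, j). f i j)) = (\<Sum>p | p permutes {0..<n}. signof p * (\<Prod>i = 0..<n. f i (p i)))"
proof -
  have "p i < n" if "p permutes {0..<n}" "i < n" for p i
    using permutes_in_image[OF that(1), of i] that(2) by simp
  hence "(\<Prod>i = 0..<n. mat n n (\<lambda>(i, j). f i j) $$ (i, p i)) = (\<Prod>i = 0..<n. f i (p i))"
    if "p permutes {0..<n}" for p
    using that by (intro prod.cong) auto
  thus ?thesis
    by (subst det_def'[of _ n]) (auto intro: sum.cong)
qed

text \<open>The principal minor on \<open>S\<close>, as a Leibniz sum over the permutations of
  \<open>S\<close> itself. Rows and columns keep their original indices, so minors on different sets
  can be added without relabelling.\<close>

definition minor :: "'a :: comm_ring_1 mat \<Rightarrow> nat set \<Rightarrow> 'a" where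
  "minor A S = (\<Sum>p | p permutes S. signof p * (\<Prod>i\<in>S. A $$ (i, p i)))"

text \<open>In each Leibniz term, expand the product of the sums and let \<open>S\<close> collect
  the rows whose factor comes from \<open>A\<close>. The other factors are diagonal entries, so they
  vanish unless the permutation fixes every point outside \<open>S\<close>; what survives is a
  permutation of \<open>S\<close>.\<close>

lemma det_add_diagonal:
  fixes A :: "'a :: comm_ring_1 mat"
  assumes "A \<in> carrier_mat n n"
  shows "det (mat n n (\<lambda>(i, j). A $$ (i, j) + (if i = j then d i else 0))) =
    (\<Sum>S\<in>Pow {0..<n}. minor A S * (\<Prod>i\<in>{0..<n} - S. d i))"
proof -
  let ?U = "{0..<n}" and ?D = "\<lambda>i j. if i = j then d i else 0"
  have "det (mat n n (\<lambda>(i, j). A $$ (i, j) + ?D i j)) =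
      (\<Sum>p | p permutes ?U. signof p * (\<Prod>i\<in>?U. A $$ (i, p i) + ?D i (p i)))"
    by (rule det_mat_eq_sum_permutes)
  also have "\<dots> = (\<Sum>p | p permutes ?U. \<Sum>S\<in>Pow ?U.
      signof p * ((\<Prod>i\<in>S. A $$ (i, p i)) * (\<Prod>i\<in>?U - S. ?D i (p i))))"
    by (simp add: prod_add sum_distrib_left)
  also have "\<dots> = (\<Sum>S\<in>Pow ?U. \<Sum>p | p permutes ?U.
      signof p * ((\<Prod>i\<in>S. A $$ (i, p i)) * (\<Prod>i\<in>?U - S. ?D i (p i))))"
    by (rule sum.swap)
  also have "\<dots> = (\<Sum>S\<in>Pow ?U. minor A S * (\<Prod>i\<in>?U - S. d i))"
  proof (rule sum.cong[OF refl])
    fix S assume "S \<in> Pow ?U"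
    hence S: "S \<subseteq> ?U" by simp
    have "(\<Sum>p | p permutes ?U. signof p * ((\<Prod>i\<in>S. A $$ (i, p i)) * (\<Prod>i\<in>?U - S. ?D i (p i)))) =
       (\<Sum>p | p permutes S. signof p * ((\<Prod>i\<in>S. A $$ (i, p i)) * (\<Prod>i\<in>?U - S. ?D i (p i))))"
    proof (rule sum.mono_neutral_right)
      show "finite {p. p permutes ?U}" by (simp add: finite_permutations)
      show "{p. p permutes S} \<subseteq> {p. p permutes ?U}" using permutes_subset[OF _ S] by auto
      show "\<forall>p\<in>{p. p permutes ?U} - {p. p permutes S}.
        signof p * ((\<Prod>i\<in>S. A $$ (i, p i)) * (\<Prod>i\<in>?U - S. ?D i (p i))) = 0"
      proof
        fix p assume "p \<in> {p. p permutes ?U} - {p. p permutes S}"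
        hence p: "p permutes ?U" "\<not> p permutes S" by auto
        then obtain i where "i \<in> ?U - S" "p i \<noteq> i"
          using permutes_superset[OF p(1)] by blast
        hence "(\<Prod>i\<in>?U - S. ?D i (p i)) = 0"
          by (intro prod_zero bexI[of _ i]) auto
        thus "signof p * ((\<Prod>i\<in>S. A $$ (i, p i)) * (\<Prod>i\<in>?U - S. ?D i (p i))) = 0"
          by (simp only: mult_zero_right)
      qed
    qed
    also have "\<dots> = (\<Sum>p | p permutes S. signof p * ((\<Prod>i\<in>S. A $$ (i, p i)) * (\<Prod>i\<in>?U - S. d i)))"
    proof (rule sum.cong[OF refl])
      fix p assume "p \<in> {p. p permutes S}"
      hence "p i = i" if "i \<notin> S" for i using that by (auto intro: permutes_not_in)
      hence "(\<Prod>i\<in>?U - S. ?D i (p i)) = (\<Prod>i\<in>?U - S. d i)" by (intro prod.cong) simp_all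
      thus "signof p * ((\<Prod>i\<in>S. A $$ (i, p i)) * (\<Prod>i\<in>?U - S. ?D i (p i))) =
          signof p * ((\<Prod>i\<in>S. A $$ (i, p i)) * (\<Prod>i\<in>?U - S. d i))" by simp
    qed
    finally show "(\<Sum>p | p permutes ?U. signof p * ((\<Prod>i\<in>S. A $$ (i, p i)) * (\<Prod>i\<in>?U - S. ?D i (p i)))) =
        minor A S * (\<Prod>i\<in>?U - S. d i)"
      by (simp add: minor_def sum_distrib_right mult.assoc)
  qed
  finally show ?thesis .
qed

text \<open>Transport along \<open>f\<close> is a sign-preserving bijection between the permutations
  of \<open>{0..<m}\<close> and those of \<open>S\<close>, and it matches the Leibniz terms one by
  one.\<close>

lemma det_reindex_eq_minor:
  fixes A :: "'a :: comm_ring_1 mat"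
  assumes "bij_betw f {0..<m} S"
  shows "det (mat m m (\<lambda>(i, j). A $$ (f i, f j))) = minor A S"
proof -
  let ?U = "{0..<m}"
  have inj: "inj_on f ?U" and img: "f ` ?U = S" using assms by (auto simp: bij_betw_def)
  let ?g = "inv_into ?U f"
  have bg: "bij_betw ?g S ?U" by (rule bij_betw_inv_into[OF assms])
  have "minor A S = (\<Sum>p | p permutes ?U. signof p * (\<Prod>i\<in>?U. A $$ (f i, f (p i))))"
    unfolding minor_def
  proof (rule sum.reindex_bij_witness[where j = "map_permutation S ?g" and i = "map_permutation ?U f"])
    fix p assume p: "p \<in> {p. p permutes S}"
    show "map_permutation ?U f (map_permutation S ?g p) = p"
      using p img by (intro map_permutation_compose_inv[OF bg]) (auto simp: f_inv_into_f)
    show P: "map_permutation S ?g p \<in> {p. p permutes ?U}"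
      using map_permutation_permutes[OF bg] p by auto
    have 1: "sign (map_permutation S ?g p) = sign p"
      using p bg img by (intro sign_map_permutation) (auto simp: bij_betw_def)
    have 2: "f (map_permutation S ?g p i) = p (f i)" if "i \<in> ?U" for i
    proof -
      have "i = ?g (f i)" using inj that by simp
      hence "map_permutation S ?g p i = ?g (p (f i))"
        using map_permutation_apply[of ?g S "f i" p] bg that img by (auto simp: bij_betw_def)
      moreover have "p (f i) \<in> f ` ?U" using p that img by (auto simp: permutes_in_image)
      ultimately show ?thesis by (simp add: f_inv_into_f)
    qed
    show "signof (map_permutation S ?g p) * (\<Prod>i\<in>?U. A $$ (f i, f (map_permutation S ?g p i))) =
        signof p * (\<Prod>i\<in>S. A $$ (i, p i))"
    proof -
      have "(\<Prod>i\<in>S. A $$ (i, p i)) = (\<Prod>i\<in>?U. A $$ (f i, p (f i)))"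
        using prod.reindex[OF inj, of "\<lambda>i. A $$ (i, p i)"] by (simp add: img)
      thus ?thesis by (simp add: 1 2)
    qed
  next
    fix p assume p: "p \<in> {p. p permutes ?U}"
    show "map_permutation S ?g (map_permutation ?U f p) = p"
      using p inj by (intro map_permutation_compose_inv[OF assms]) auto
    show "map_permutation ?U f p \<in> {p. p permutes S}"
      using map_permutation_permutes[OF assms] p by auto
  qed
  thus ?thesis
    by (simp add: det_mat_eq_sum_permutes)
qed

subsection \<open>Sampling matrices and principal submatrices\<close>

lemma bij_betw_pick:
  assumes "finite S"
  shows "bij_betw (pick S) {0..<card S} S"
proof (rule bij_betw_imageI)
  \<comment> \<open>The left inverse is the rank: the number of elements of \<open>S\<close> below
    the given one.\<close>
  show "inj_on (pick S) {0..<card S}"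
    by (rule inj_on_inverseI[where g = "\<lambda>i. card {a \<in> S. a < i}"]) (simp add: card_pick)
  thus "pick S ` {0..<card S} = S"
    using assms by (intro card_subset_eq) (auto simp: pick_in_set card_image)
qed

lemma sampling_mat_carrier:
  assumes "S \<subseteq> {0..<n}"
  shows "sampling_mat n S \<in> carrier_mat n (card S)"
proof (rule carrier_matI)
  have "{j. j < n \<and> j \<in> S} = S" using assms by auto
  thus "dim_col (sampling_mat n S) = card S"
    unfolding sampling_mat_def dim_submatrix index_one_mat by (rule arg_cong)
  show "dim_row (sampling_mat n S) = n"
    by (simp add: sampling_mat_def dim_submatrix)
qed

lemma sampling_mat_index:
  assumes "S \<subseteq> {0..<n}" "i < n" "j < card S"
  shows "sampling_mat n S $$ (i, j) = (if i = pick S j then 1 else 0)"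
proof -
  have S: "{j. j < n \<and> j \<in> S} = S" using assms by auto
  have "pick S j < n" using assms pick_in_set[of j S] by auto
  thus ?thesis using assms S
    by (auto simp: sampling_mat_def submatrix_index pick_UNIV)
qed

lemma mult_mat_index_sum:
  assumes "A \<in> carrier_mat nr m" "B \<in> carrier_mat m nc" "i < nr" "j < nc"
  shows "(A * B) $$ (i, j) = (\<Sum>l = 0..<m. A $$ (i, l) * B $$ (l, j))"
  using assms by (simp add: scalar_prod_def)

text \<open>Each column of the sampling matrix has a single entry 1, so both matrix products
  collapse to one summand.\<close>

lemma principal_submat_eq:
  assumes K: "K \<in> carrier_mat n n" and S: "S \<subseteq> {0..<n}"
  shows "principal_submat K S = mat (card S) (card S) (\<lambda>(i, j). K $$ (pick S i, pick S j))"
proof -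
  let ?C = "sampling_mat n S"
  note C = sampling_mat_carrier[OF S]
  have CK: "transpose_mat ?C * K \<in> carrier_mat (card S) n" using C K by auto
  have pk: "pick S i < n" if "i < card S" for i using S that pick_in_set[of i S] by auto
  have 1: "(transpose_mat ?C * K) $$ (i, b) = K $$ (pick S i, b)"
    if "i < card S" "b < n" for i b
  proof -
    have "(transpose_mat ?C * K) $$ (i, b) = (\<Sum>a = 0..<n. transpose_mat ?C $$ (i, a) * K $$ (a, b))"
      using C K that by (intro mult_mat_index_sum) auto
    also have "\<dots> = (\<Sum>a = 0..<n. if a = pick S i then K $$ (a, b) else 0)"
      using C that by (intro sum.cong) (auto simp: sampling_mat_index[OF S])
    finally show ?thesis using pk[OF that(1)] by simp
  qed
  have 2: "(transpose_mat ?C * K * ?C) $$ (i, j) = K $$ (pick S i, pick S j)"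
    if "i < card S" "j < card S" for i j
  proof -
    have "(transpose_mat ?C * K * ?C) $$ (i, j) =
      (\<Sum>b = 0..<n. (transpose_mat ?C * K) $$ (i, b) * ?C $$ (b, j))"
      using CK C that by (intro mult_mat_index_sum) auto
    also have "\<dots> = (\<Sum>b = 0..<n. if b = pick S j then K $$ (pick S i, b) else 0)"
      using that by (intro sum.cong refl) (simp add: 1 sampling_mat_index[OF S])
    finally show ?thesis using pk[OF that(2)] by simp
  qed
  have "dim_row K = n" using K by simp
  thus ?thesis
    unfolding principal_submat_def
    using C 2 by (intro eq_matI) simp_all
qed

lemma det_principal_submat:
  assumes "K \<in> carrier_mat n n" and "S \<subseteq> {0..<n}"
  shows "det (principal_submat K S) = minor K S"
  unfolding principal_submat_eq[OF assms]
  using assms(2) by (intro det_reindex_eq_minor bij_betw_pick) (auto simp: subset_eq_atLeast0_lessThan_finite)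

subsection \<open>Adjugates and padded inverses\<close>

text \<open>Laplace expansion along row \<open>b\<close>: the cofactors of that row do not see the
  row itself, so they are those of \<open>A\<close>, and the adjugate stores them
  transposed.\<close>

lemma det_replace_row:
  fixes A :: "'a :: comm_ring_1 mat"
  assumes A: "A \<in> carrier_mat n n" and b: "b < n"
  shows "det (mat n n (\<lambda>(i, j). if i = b then r j else A $$ (i, j))) = (\<Sum>j = 0..<n. r j * adj_mat A $$ (j, b))"
proof -
  let ?R = "mat n n (\<lambda>(i, j). if i = b then r j else A $$ (i, j))"
  have "mat_delete ?R b j = mat_delete A b j" for j
    using A unfolding mat_delete_def by (intro eq_matI) auto
  hence "cofactor ?R b j = cofactor A b j" for j
    by (simp add: cofactor_def)
  moreover have "adj_mat A $$ (j, b) = cofactor A b j" if "j < n" for j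
    using A b that by (simp add: adj_mat_def)
  ultimately show ?thesis
    using laplace_expansion_row[of ?R n b] b by (simp add: atLeast0LessThan)
qed

text \<open>Multiplying \<open>A * B = 1\<close> by the adjugate from the left gives the
  division-free form of the inverse. It is stated with \<open>det A\<close> as a factor because that
  factor is the unnormalised weight of the k-DPP.\<close>

lemma mat_inverse_adj:
  fixes A :: "'a :: field mat"
  assumes A: "A \<in> carrier_mat n n" and d: "det A \<noteq> 0"
  obtains B where "mat_inverse A = Some B" "B \<in> carrier_mat n n"
    "\<And>i j. i < n \<Longrightarrow> j < n \<Longrightarrow> det A * B $$ (i, j) = adj_mat A $$ (i, j)"
proof -
  obtain B where B: "mat_inverse A = Some B"
    using mat_inverse(1)[OF A, where b = "()"] det_non_zero_imp_unit[OF A d, of "()"] by (cases "mat_inverse A") auto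
  note AB = mat_inverse(2)[OF A B]
  have "adj_mat A = adj_mat A * (A * B)"
    using AB adj_mat(1)[OF A] by simp
  also have "\<dots> = (adj_mat A * A) * B"
    using AB adj_mat(1)[OF A] A by (simp add: assoc_mult_mat[of _ n n _ n _ n])
  also have "\<dots> = det A \<cdot>\<^sub>m B"
    unfolding adj_mat(3)[OF A] using AB
    by (subst mult_smult_assoc_mat[of _ n n _ n]) auto
  finally have "adj_mat A = det A \<cdot>\<^sub>m B" .
  hence "det A * B $$ (i, j) = adj_mat A $$ (i, j)" if "i < n" "j < n" for i j
    using AB that by auto
  thus ?thesis using that[OF B] AB by blast
qed

text \<open>A device for adjugate entries: by \<open>det_unit_row\<close> its determinant is the
  entry \<open>(a, b)\<close>, with the indices transposed. Unlike deleting a row and a column,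
  replacing a row keeps the size and the indices, so \<open>det_add_diagonal\<close> still
  applies.\<close>

definition unit_row :: "'a :: zero_neq_one mat \<Rightarrow> nat \<Rightarrow> nat \<Rightarrow> 'a mat" where
  "unit_row A b a = mat (dim_row A) (dim_col A)
     (\<lambda>(i, j). if i = b then (if j = a then 1 else 0) else A $$ (i, j))"

lemma unit_row_carrier: "A \<in> carrier_mat m n \<Longrightarrow> unit_row A b a \<in> carrier_mat m n"
  by (auto simp: unit_row_def)

lemma unit_row_index:
  "A \<in> carrier_mat m n \<Longrightarrow> i < m \<Longrightarrow> j < n \<Longrightarrow>
   unit_row A b a $$ (i, j) = (if i = b then (if j = a then 1 else 0) else A $$ (i, j))"
  by (simp add: unit_row_def)

lemma det_unit_row:
  fixes A :: "'a :: comm_ring_1 mat"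
  assumes A: "A \<in> carrier_mat n n" and "a < n" "b < n"
  shows "det (unit_row A b a) = adj_mat A $$ (a, b)"
proof -
  have "det (unit_row A b a) = (\<Sum>j = 0..<n. (if j = a then 1 else 0) * adj_mat A $$ (j, b))"
    using A unfolding det_replace_row[OF A assms(3), symmetric] by (simp add: unit_row_def)
  also have "\<dots> = (\<Sum>j = 0..<n. if j = a then adj_mat A $$ (j, b) else 0)"
    by (intro sum.cong) auto
  finally show ?thesis using assms by simp
qed

text \<open>The condition \<open>b \<in> S\<close> is needed: if \<open>b \<notin> S\<close>, the minor on \<open>S\<close> does not see the
  replaced row. If only \<open>a \<notin> S\<close>, both sides vanish, since the replaced row is zero on \<open>S\<close>.\<close>

lemma padded_inverse_index:
  assumes K: "K \<in> carrier_mat n n" and S: "S \<subseteq> {0..<n}" and a: "a < n" and b: "b < n"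
    and d: "det (principal_submat K S) \<noteq> 0"
  shows "det (principal_submat K S) *
      (sampling_mat n S * the (mat_inverse (principal_submat K S)) * transpose_mat (sampling_mat n S)) $$ (a, b) =
    (if b \<in> S then minor (unit_row K b a) S else 0)"
proof -
  let ?C = "sampling_mat n S" and ?P = "principal_submat K S" and ?m = "card S"
  note C = sampling_mat_carrier[OF S]
  note P_eq = principal_submat_eq[OF K S]
  have P: "?P \<in> carrier_mat ?m ?m" by (simp add: P_eq)
  have fin: "finite S" using S by (rule finite_subset) simp
  note bij = bij_betw_pick[OF fin]
  obtain B where B: "mat_inverse ?P = Some B" "B \<in> carrier_mat ?m ?m"
    "\<And>i j. i < ?m \<Longrightarrow> j < ?m \<Longrightarrow> det ?P * B $$ (i, j) = adj_mat ?P $$ (i, j)"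
    using mat_inverse_adj[OF P d] by blast
  have CB: "?C * B \<in> carrier_mat n ?m" using C B(2) by auto
  have 1: "(?C * B) $$ (a, q) = (\<Sum>p = 0..<?m. (if a = pick S p then 1 else 0) * B $$ (p, q))"
    if "q < ?m" for q
  proof -
    have "(?C * B) $$ (a, q) = (\<Sum>p = 0..<?m. ?C $$ (a, p) * B $$ (p, q))"
      by (rule mult_mat_index_sum[OF C B(2) a that])
    also have "\<dots> = (\<Sum>p = 0..<?m. (if a = pick S p then 1 else 0) * B $$ (p, q))"
      by (intro sum.cong refl) (simp add: sampling_mat_index[OF S a])
    finally show ?thesis .
  qed
  have 2: "(?C * B * transpose_mat ?C) $$ (a, b) =
      (\<Sum>q = 0..<?m. (if b = pick S q then (?C * B) $$ (a, q) else 0))"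
  proof -
    have "(?C * B * transpose_mat ?C) $$ (a, b) = (\<Sum>q = 0..<?m. (?C * B) $$ (a, q) * transpose_mat ?C $$ (q, b))"
      by (rule mult_mat_index_sum[OF CB _ a b]) (use C in simp)
    also have "\<dots> = (\<Sum>q = 0..<?m. (if b = pick S q then (?C * B) $$ (a, q) else 0))"
      using C b by (intro sum.cong refl) (simp add: sampling_mat_index[OF S b])
    finally show ?thesis .
  qed
  show ?thesis
  proof (cases "b \<in> S")
    \<comment> \<open>Column \<open>b\<close> of the padded matrix is zero, since no sampled index
      equals \<open>b\<close>.\<close>
    case False
    have "pick S q \<in> S" if "q < ?m" for q using that by (simp add: pick_in_set)
    hence "(\<Sum>q = 0..<?m. (if b = pick S q then (?C * B) $$ (a, q) else 0)) = 0"
      using False by (intro sum.neutral) auto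
    thus ?thesis using False 2 B(1) by simp
  next
    case True
    \<comment> \<open>\<open>q\<close> is the position of \<open>b\<close> in \<open>S\<close>, so
      column \<open>b\<close> of the padded matrix comes from column \<open>q\<close> of the
      inverse.\<close>
    then obtain q where q: "q < ?m" "b = pick S q"
      using bij by (force simp: bij_betw_def)
    have eq: "b = pick S q' \<longleftrightarrow> q' = q" if "q' < ?m" for q'
      using bij q that by (auto simp: bij_betw_def inj_on_def)
    have "(?C * B * transpose_mat ?C) $$ (a, b) = (\<Sum>q' = 0..<?m. (if q' = q then (?C * B) $$ (a, q') else 0))"
      unfolding 2 using eq by (intro sum.cong) auto
    also have "\<dots> = (\<Sum>p = 0..<?m. (if a = pick S p then 1 else 0) * B $$ (p, q))"
      using q 1 by simp
    finally have "det ?P * (?C * B * transpose_mat ?C) $$ (a, b) =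
       (\<Sum>p = 0..<?m. (if a = pick S p then 1 else 0) * (det ?P * B $$ (p, q)))"
      by (simp add: sum_distrib_left mult.left_commute)
    also have "\<dots> = (\<Sum>p = 0..<?m. (if a = pick S p then 1 else 0) * adj_mat ?P $$ (p, q))"
      using B(3) q(1) by (intro sum.cong refl) simp
    also have "\<dots> = det (mat ?m ?m (\<lambda>(i, j). if i = q then (if a = pick S j then 1 else 0) else ?P $$ (i, j)))"
      by (rule det_replace_row[OF P q(1), symmetric])
    \<comment> \<open>Replacing a row commutes with restricting to \<open>S\<close>: position
      \<open>q\<close> corresponds to index \<open>b\<close>.\<close>
    also have "mat ?m ?m (\<lambda>(i, j). if i = q then (if a = pick S j then 1 else 0) else ?P $$ (i, j)) =
        mat ?m ?m (\<lambda>(i, j). unit_row K b a $$ (pick S i, pick S j))"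
    proof (rule cong_mat)
      fix i j assume ij: "i < ?m" "j < ?m"
      have "pick S i < n" "pick S j < n" using S ij pick_in_set[of _ S] by force+
      thus "(case (i, j) of (i, j) \<Rightarrow> if i = q then (if a = pick S j then 1 else 0) else ?P $$ (i, j)) =
         (case (i, j) of (i, j) \<Rightarrow> unit_row K b a $$ (pick S i, pick S j))"
        using eq[OF ij(1)] ij by (auto simp: unit_row_index[OF K] P_eq)
    qed simp_all
    also have "det \<dots> = minor (unit_row K b a) S"
      by (rule det_reindex_eq_minor[OF bij])
    finally show ?thesis using True B(1) by simp
  qed
qed

subsection \<open>Elementary symmetric sums\<close>

text \<open>A real polynomial vanishing on all positive reals has infinitely many roots and is zero.
  Working with positive \<open>x\<close> only keeps shifted positive eigenvalues away from 0.
  Exponents may repeat, hence the sums over all indices with exponent \<open>m\<close>.\<close>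

lemma sum_powers_eq_imp_coeff_eq:
  fixes f :: "'a \<Rightarrow> real" and g :: "'b \<Rightarrow> real"
  assumes fin: "finite I" "finite J"
    and eq: "\<And>x. x > 0 \<Longrightarrow> (\<Sum>i\<in>I. f i * x ^ p i) = (\<Sum>j\<in>J. g j * x ^ q j)"
  shows "(\<Sum>i | i \<in> I \<and> p i = m. f i) = (\<Sum>j | j \<in> J \<and> q j = m. g j)"
proof -
  define P where "P = (\<Sum>i\<in>I. monom (f i) (p i)) - (\<Sum>j\<in>J. monom (g j) (q j))"
  have "poly P x = 0" if "x > 0" for x
    using eq[OF that] by (simp add: P_def poly_sum poly_monom)
  hence "{0<..} \<subseteq> {x. poly P x = 0}" by auto
  hence "infinite {x. poly P x = 0}"
    using infinite_Ioi[of "0 :: real"] finite_subset by blast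
  hence "P = 0" using poly_roots_finite by blast
  hence "coeff P m = 0" by simp
  hence "(\<Sum>i\<in>I. if p i = m then f i else 0) = (\<Sum>j\<in>J. if q j = m then g j else 0)"
    by (simp add: P_def coeff_sum)
  thus ?thesis using fin by (simp add: sum.inter_filter)
qed

text \<open>Elementary symmetric polynomials over an index set: removing an entry becomes a set
  difference, with no renumbering of the others.\<close>

definition esum :: "nat \<Rightarrow> (nat \<Rightarrow> 'a :: comm_semiring_1) \<Rightarrow> nat set \<Rightarrow> 'a" where
  "esum k f A = (\<Sum>S | S \<subseteq> A \<and> card S = k. \<Prod>i\<in>S. f i)"

lemma elem_sym_eq_esum: "elem_sym k \<mu> = esum k (\<lambda>i. \<mu> $ i) {0..<dim_vec \<mu>}"
  by (simp add: elem_sym_def esum_def)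

lemma esum_image:
  assumes "inj_on h A"
  shows "esum k f (h ` A) = esum k (\<lambda>i. f (h i)) A"
proof -
  have "bij_betw (image h) {S. S \<subseteq> A \<and> card S = k} {S. S \<subseteq> h ` A \<and> card S = k}"
  proof (rule bij_betw_imageI)
    show "inj_on (image h) {S. S \<subseteq> A \<and> card S = k}"
      using inj_on_image_Pow[OF assms] by (rule inj_on_subset) auto
    show "image h ` {S. S \<subseteq> A \<and> card S = k} = {S. S \<subseteq> h ` A \<and> card S = k}"
    proof (intro equalityI subsetI)
      fix T assume "T \<in> {S. S \<subseteq> h ` A \<and> card S = k}"
      then obtain S where "S \<subseteq> A" "T = h ` S" "card T = k" by (auto simp: subset_image_iff)
      thus "T \<in> image h ` {S. S \<subseteq> A \<and> card S = k}"
        using card_image[OF inj_on_subset[OF assms]] by auto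
    next
      fix T assume "T \<in> image h ` {S. S \<subseteq> A \<and> card S = k}"
      thus "T \<in> {S. S \<subseteq> h ` A \<and> card S = k}"
        using card_image[OF inj_on_subset[OF assms]] by auto
    qed
  qed
  hence "esum k f (h ` A) = (\<Sum>S | S \<subseteq> A \<and> card S = k. \<Prod>i\<in>h ` S. f i)"
    unfolding esum_def by (rule sum.reindex_bij_betw[symmetric])
  also have "\<dots> = esum k (\<lambda>i. f (h i)) A"
    unfolding esum_def
    by (intro sum.cong refl) (auto simp: prod.reindex[OF inj_on_subset[OF assms]])
  finally show ?thesis .
qed

text \<open>The renumbering \<open>insert_index l\<close> maps the positions of the shortened vector
  bijectively onto the indices other than \<open>l\<close>.\<close>

lemma elem_sym_remove_entry:
  assumes "l < dim_vec \<mu>"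
  shows "elem_sym k (remove_entry l \<mu>) = esum k (\<lambda>i. \<mu> $ i) ({0..<dim_vec \<mu>} - {l})"
proof -
  obtain m where m: "dim_vec \<mu> = Suc m" using assms by (cases "dim_vec \<mu>") auto
  have "elem_sym k (remove_entry l \<mu>) = esum k (\<lambda>i. remove_entry l \<mu> $ i) {0..<m}"
    by (simp add: elem_sym_eq_esum remove_entry_def m)
  also have "\<dots> = esum k (\<lambda>i. \<mu> $ insert_index l i) {0..<m}"
    unfolding esum_def by (intro sum.cong prod.cong refl) (auto simp: remove_entry_def m)
  also have "\<dots> = esum k (\<lambda>i. \<mu> $ i) (insert_index l ` {0..<m})"
    by (rule esum_image[symmetric]) (rule insert_index_inj_on)
  also have "insert_index l ` {0..<m} = {0..<dim_vec \<mu>} - {l}"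
    using insert_index_image[of l m] assms m by simp
  finally show ?thesis .
qed

text \<open>Split the subsets by whether they contain \<open>l\<close>. This recursion turns the
  final quotient into the stated denominator.\<close>

lemma esum_insert:
  assumes "finite A" "l \<notin> A"
  shows "esum (Suc k) f (insert l A) = f l * esum k f A + esum (Suc k) f A"
proof -
  let ?P = "\<lambda>k. {S. S \<subseteq> A \<and> card S = k}"
  have fin: "finite S" if "S \<in> ?P k" for S k using that assms(1) finite_subset by blast
  have split: "{S. S \<subseteq> insert l A \<and> card S = Suc k} = insert l ` ?P k \<union> ?P (Suc k)"
  proof (intro equalityI subsetI)
    fix S assume S: "S \<in> {S. S \<subseteq> insert l A \<and> card S = Suc k}"
    hence "finite S" using assms(1) finite_subset[of S "insert l A"] by simp
    show "S \<in> insert l ` ?P k \<union> ?P (Suc k)"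
    proof (cases "l \<in> S")
      case True
      hence "S = insert l (S - {l})" by auto
      moreover have "S - {l} \<in> ?P k" using S True \<open>finite S\<close> by auto
      ultimately show ?thesis by blast
    next
      case False
      thus ?thesis using S by auto
    qed
  next
    fix S assume "S \<in> insert l ` ?P k \<union> ?P (Suc k)"
    thus "S \<in> {S. S \<subseteq> insert l A \<and> card S = Suc k}"
    proof
      assume "S \<in> insert l ` ?P k"
      then obtain T where T: "T \<in> ?P k" "S = insert l T" by blast
      thus ?thesis using fin[OF T(1)] assms(2) by (auto simp: card_insert_if)
    qed auto
  qed
  have inj: "inj_on (insert l) (?P k)"
  proof (rule inj_onI)
    fix S T assume "S \<in> ?P k" "T \<in> ?P k" "insert l S = insert l T"
    moreover from this have "l \<notin> S" "l \<notin> T" using assms(2) by auto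
    ultimately show "S = T" using insert_ident by metis
  qed
  have "esum (Suc k) f (insert l A) = (\<Sum>S\<in>insert l ` ?P k. prod f S) + esum (Suc k) f A"
    unfolding esum_def split using assms by (intro sum.union_disjoint) auto
  also have "(\<Sum>S\<in>insert l ` ?P k. prod f S) = (\<Sum>S\<in>?P k. prod f (insert l S))"
    by (rule sum.reindex[OF inj, unfolded o_def])
  also have "\<dots> = (\<Sum>S\<in>?P k. f l * prod f S)"
    using assms(2) fin by (intro sum.cong refl prod.insert) auto
  also have "\<dots> = f l * esum k f A"
    by (simp add: esum_def sum_distrib_left)
  finally show ?thesis .
qed

lemma esum_pos:
  fixes f :: "nat \<Rightarrow> real"
  assumes "finite A" "k \<le> card A" "\<And>i. i \<in> A \<Longrightarrow> f i > 0"
  shows "esum k f A > 0"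
  unfolding esum_def
proof (rule sum_pos)
  show "finite {S. S \<subseteq> A \<and> card S = k}" using assms(1) by simp
  show "{S. S \<subseteq> A \<and> card S = k} \<noteq> {}" using obtain_subset_with_card_n[OF assms(2)] by blast
  show "0 < prod f S" if "S \<in> {S. S \<subseteq> A \<and> card S = k}" for S
    using that assms(3) by (intro prod_pos) auto
qed

text \<open>Vieta's formula: grouped by the size of \<open>S\<close>, the coefficient of
  \<open>x ^ (card A - j)\<close> is the \<open>j\<close>-th elementary symmetric
  polynomial.\<close>

lemma prod_shift_expand:
  fixes f :: "nat \<Rightarrow> real"
  assumes "finite A"
  shows "(\<Prod>i\<in>A. x + f i) = (\<Sum>S\<in>Pow A. (\<Prod>i\<in>S. f i) * x ^ (card A - card S))"
proof -
  have "(\<Prod>i\<in>A. x + f i) = (\<Prod>i\<in>A. f i + x)" by (simp add: add.commute)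
  also have "\<dots> = (\<Sum>S\<in>Pow A. (\<Prod>i\<in>S. f i) * (\<Prod>i\<in>A - S. x))"
    by (rule prod_add[OF assms])
  also have "\<dots> = (\<Sum>S\<in>Pow A. (\<Prod>i\<in>S. f i) * x ^ (card A - card S))"
    using assms by (intro sum.cong refl) (auto simp: card_Diff_subset finite_subset)
  finally show ?thesis .
qed

subsection \<open>Matrices with a given orthonormal eigenbasis\<close>

text \<open>Functional calculus in a fixed eigenbasis. The kernel, its shifts, their adjugates and
  the expected matrix all have this form and differ only in \<open>f\<close>.\<close>

definition spectral_mat :: "nat \<Rightarrow> (nat \<Rightarrow> real vec) \<Rightarrow> (nat \<Rightarrow> real) \<Rightarrow> real mat" where
  "spectral_mat n v f = mat n n (\<lambda>(i, j). \<Sum>l = 0..<n. f l * (v l $ i * v l $ j))"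

lemma spectral_mat_carrier [simp]: "spectral_mat n v f \<in> carrier_mat n n"
  by (simp add: spectral_mat_def)

lemma mat_sum_outer_prod:
  assumes "\<And>i. i < n \<Longrightarrow> v i \<in> carrier_vec n"
  shows "mat_sum n n (\<lambda>l. f l \<cdot>\<^sub>m outer_prod (v l) (v l)) {0..<n} = spectral_mat n v f"
  unfolding mat_sum_def spectral_mat_def
proof (rule cong_mat)
  fix i j assume ij: "i < n" "j < n"
  have "dim_vec (v l) = n" if "l < n" for l using assms[OF that] by simp
  thus "(case (i, j) of (i, j) \<Rightarrow> \<Sum>l\<in>{0..<n}. (f l \<cdot>\<^sub>m outer_prod (v l) (v l)) $$ (i, j)) =
     (case (i, j) of (i, j) \<Rightarrow> \<Sum>l = 0..<n. f l * (v l $ i * v l $ j))"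
    using ij by (auto simp: outer_prod_def intro!: sum.cong)
qed simp_all

context
  fixes n :: nat and v :: "nat \<Rightarrow> real vec"
  assumes v_carrier: "\<And>i. i < n \<Longrightarrow> v i \<in> carrier_vec n"
    and v_orthonormal: "\<And>i j. i < n \<Longrightarrow> j < n \<Longrightarrow> v i \<bullet> v j = (if i = j then 1 else 0)"
begin

text \<open>Diagonalisation by the matrix \<open>V\<close> whose columns are the eigenvectors; its
  transpose is its inverse by orthonormality.\<close>

lemma spectral_mat_similar_diag: "similar_mat (spectral_mat n v f) (mat_diag n f)"
proof -
  define V where "V = mat n n (\<lambda>(i, l). v l $ i)"
  have V: "V \<in> carrier_mat n n" "transpose_mat V \<in> carrier_mat n n" by (auto simp: V_def)
  have "(transpose_mat V * V) $$ (i, j) = 1\<^sub>m n $$ (i, j)" if "i < n" "j < n" for i j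
  proof -
    have "(transpose_mat V * V) $$ (i, j) = (\<Sum>l = 0..<n. v i $ l * v j $ l)"
      using that mult_mat_index_sum[OF V(2,1) that] by (simp add: V_def)
    also have "\<dots> = v i \<bullet> v j"
      using v_carrier[OF that(2)] by (simp add: scalar_prod_def)
    finally show ?thesis using v_orthonormal that by simp
  qed
  hence VtV: "transpose_mat V * V = 1\<^sub>m n" using V by (intro eq_matI) auto
  \<comment> \<open>For square matrices a one-sided inverse is two-sided; this is where having
    \<open>n\<close> vectors in dimension \<open>n\<close> yields completeness.\<close>
  have VVt: "V * transpose_mat V = 1\<^sub>m n" by (rule mat_mult_left_right_inverse[OF V(2,1) VtV])
  have "spectral_mat n v f = V * mat_diag n f * transpose_mat V"
  proof (rule eq_matI)
    fix i j assume "i < dim_row (V * mat_diag n f * transpose_mat V)"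
      "j < dim_col (V * mat_diag n f * transpose_mat V)"
    hence ij: "i < n" "j < n" using V by auto
    have VD: "V * mat_diag n f \<in> carrier_mat n n" using V by simp
    have "(V * mat_diag n f * transpose_mat V) $$ (i, j) = (\<Sum>l = 0..<n. (v l $ i * f l) * v l $ j)"
      unfolding mult_mat_index_sum[OF VD V(2) ij]
      using ij by (intro sum.cong refl) (simp add: mat_diag_mult_right[OF V(1)], simp add: V_def)
    thus "spectral_mat n v f $$ (i, j) = (V * mat_diag n f * transpose_mat V) $$ (i, j)"
      using ij by (simp add: spectral_mat_def ac_simps)
  qed (use V in \<open>simp_all add: spectral_mat_def\<close>)
  thus ?thesis using V VVt VtV
    by (intro similar_matI[where n = n and P = V and Q = "transpose_mat V"]) auto
qed

lemma det_spectral_mat: "det (spectral_mat n v f) = (\<Prod>l = 0..<n. f l)"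
proof -
  have "det (mat_diag n f) = (\<Prod>l = 0..<n. f l)"
    by (subst det_upper_triangular[of _ n])
       (auto simp: upper_triangular_def mat_diag_def diag_mat_def prod.list_conv_set_nth
         simp flip: prod.distinct_set_conv_list intro!: prod.cong)
  thus ?thesis using det_similar[OF spectral_mat_similar_diag] by simp
qed

lemma char_poly_spectral_mat: "char_poly (spectral_mat n v f) = (\<Prod>l\<leftarrow>[0..<n]. [:- f l, 1:])"
proof -
  have "diag_mat (mat_diag n f) = map f [0..<n]"
    by (auto simp: diag_mat_def mat_diag_def)
  moreover have "char_poly (mat_diag n f) = (\<Prod>a\<leftarrow>diag_mat (mat_diag n f). [:- a, 1:])"
    by (rule char_poly_upper_triangular[of _ n]) (auto simp: upper_triangular_def mat_diag_def)
  ultimately show ?thesis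
    using char_poly_similar[OF spectral_mat_similar_diag] by (simp add: o_def)
qed

text \<open>Resolution of the identity, scaled by \<open>c\<close>: a scalar matrix is unchanged by
  conjugation.\<close>

lemma spectral_mat_const:
  "spectral_mat n v (\<lambda>_. c) = c \<cdot>\<^sub>m 1\<^sub>m n"
proof -
  obtain P Q where PQ: "similar_mat_wit (spectral_mat n v (\<lambda>_. c)) (mat_diag n (\<lambda>_. c)) P Q"
    using spectral_mat_similar_diag unfolding similar_mat_def by blast
  have "mat_diag n (\<lambda>_. c) = c \<cdot>\<^sub>m 1\<^sub>m n" by (intro eq_matI) (auto simp: mat_diag_def)
  with PQ have "P * Q = 1\<^sub>m n" "P \<in> carrier_mat n n" "Q \<in> carrier_mat n n"
    "spectral_mat n v (\<lambda>_. c) = P * (c \<cdot>\<^sub>m 1\<^sub>m n) * Q"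
    using spectral_mat_carrier[of n v "\<lambda>_. c"] by (auto simp: similar_mat_wit_def Let_def)
  thus ?thesis
    by (simp add: mult_smult_distrib[of _ n n _ n] mult_smult_assoc_mat[of _ n n _ n])
qed

text \<open>Summing over the inner index produces the scalar products of the basis vectors, so
  orthonormality removes the cross terms.\<close>

lemma spectral_mat_mult:
  "spectral_mat n v f * spectral_mat n v g = spectral_mat n v (\<lambda>l. f l * g l)"
proof (rule eq_matI)
  fix i j assume "i < dim_row (spectral_mat n v (\<lambda>l. f l * g l))"
    "j < dim_col (spectral_mat n v (\<lambda>l. f l * g l))"
  hence ij: "i < n" "j < n" by (auto simp: spectral_mat_def)
  have "(spectral_mat n v f * spectral_mat n v g) $$ (i, j) =
    (\<Sum>m = 0..<n. (\<Sum>l = 0..<n. f l * (v l $ i * v l $ m)) * (\<Sum>l' = 0..<n. g l' * (v l' $ m * v l' $ j)))"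
    unfolding mult_mat_index_sum[OF spectral_mat_carrier spectral_mat_carrier ij]
    using ij by (intro sum.cong refl) (simp add: spectral_mat_def)
  also have "\<dots> = (\<Sum>m = 0..<n. \<Sum>l = 0..<n. \<Sum>l' = 0..<n.
      f l * v l $ i * g l' * v l' $ j * (v l $ m * v l' $ m))"
    by (simp add: sum_product ac_simps)
  also have "\<dots> = (\<Sum>l = 0..<n. \<Sum>m = 0..<n. \<Sum>l' = 0..<n.
      f l * v l $ i * g l' * v l' $ j * (v l $ m * v l' $ m))"
    by (rule sum.swap)
  also have "\<dots> = (\<Sum>l = 0..<n. \<Sum>l' = 0..<n. \<Sum>m = 0..<n.
      f l * v l $ i * g l' * v l' $ j * (v l $ m * v l' $ m))"
    by (intro sum.cong refl sum.swap)
  also have "\<dots> = (\<Sum>l = 0..<n. \<Sum>l' = 0..<n. f l * v l $ i * g l' * v l' $ j * (v l \<bullet> v l'))"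
  proof (intro sum.cong refl)
    fix l l' assume "l' \<in> {0..<n}"
    hence "dim_vec (v l') = n" using v_carrier by auto
    thus "(\<Sum>m = 0..<n. f l * v l $ i * g l' * v l' $ j * (v l $ m * v l' $ m)) =
      f l * v l $ i * g l' * v l' $ j * (v l \<bullet> v l')"
      by (simp add: scalar_prod_def sum_distrib_left)
  qed
  also have "\<dots> = (\<Sum>l = 0..<n. \<Sum>l' = 0..<n. if l = l' then f l * v l $ i * g l' * v l' $ j else 0)"
    by (intro sum.cong refl) (simp add: v_orthonormal)
  also have "\<dots> = (\<Sum>l = 0..<n. f l * g l * (v l $ i * v l $ j))"
    by (simp add: ac_simps)
  finally show "(spectral_mat n v f * spectral_mat n v g) $$ (i, j) =
      spectral_mat n v (\<lambda>l. f l * g l) $$ (i, j)"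
    using ij by (simp add: spectral_mat_def)
qed (auto simp: spectral_mat_def)

lemma spectral_mat_shift:
  "mat n n (\<lambda>(i, j). spectral_mat n v f $$ (i, j) + (if i = j then x else 0)) = spectral_mat n v (\<lambda>l. x + f l)"
proof (rule eq_matI)
  fix i j assume "i < dim_row (spectral_mat n v (\<lambda>l. x + f l))" "j < dim_col (spectral_mat n v (\<lambda>l. x + f l))"
  hence ij: "i < n" "j < n" by (auto simp: spectral_mat_def)
  have "(\<Sum>l = 0..<n. x * (v l $ i * v l $ j)) = (if i = j then x else 0)"
    using arg_cong[OF spectral_mat_const[of x], of "\<lambda>A. A $$ (i, j)"] ij by (simp add: spectral_mat_def)
  thus "mat n n (\<lambda>(i, j). spectral_mat n v f $$ (i, j) + (if i = j then x else 0)) $$ (i, j) =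
      spectral_mat n v (\<lambda>l. x + f l) $$ (i, j)"
    using ij by (simp add: spectral_mat_def distrib_right sum.distrib)
qed (simp_all add: spectral_mat_def)

text \<open>The claimed matrix \<open>?G\<close> satisfies \<open>?M * ?G = ?d I\<close>.
  Multiplying by the adjugate from the left leaves \<open>?d\<close> times the adjugate equal to
  \<open>?d\<close> times \<open>?G\<close>, and nonzero \<open>f\<close> allows \<open>?d\<close>
  to be cancelled.\<close>

lemma adj_spectral_mat:
  assumes "\<And>l. l < n \<Longrightarrow> f l \<noteq> 0"
  shows "adj_mat (spectral_mat n v f) = spectral_mat n v (\<lambda>l. \<Prod>m\<in>{0..<n} - {l}. f m)"
proof -
  let ?M = "spectral_mat n v f" and ?G = "spectral_mat n v (\<lambda>l. \<Prod>m\<in>{0..<n} - {l}. f m)"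
  let ?d = "det ?M"
  have d: "?d \<noteq> 0" using assms by (simp add: det_spectral_mat)
  note adj = adj_mat[OF spectral_mat_carrier[of n v f]]
  have "?M * ?G = spectral_mat n v (\<lambda>_. \<Prod>m = 0..<n. f m)"
  proof -
    have "f l * (\<Prod>m\<in>{0..<n} - {l}. f m) = (\<Prod>m = 0..<n. f m)" if "l < n" for l
      using that by (intro prod.remove[symmetric]) auto
    thus ?thesis
      unfolding spectral_mat_mult unfolding spectral_mat_def
      by (intro cong_mat refl) auto
  qed
  hence MG: "?M * ?G = ?d \<cdot>\<^sub>m 1\<^sub>m n" by (simp add: spectral_mat_const det_spectral_mat)
  have "?d \<cdot>\<^sub>m adj_mat ?M = adj_mat ?M * (?M * ?G)"
    unfolding MG using adj(1) by (simp add: mult_smult_distrib[of _ n n _ n])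
  also have "\<dots> = adj_mat ?M * ?M * ?G"
    using adj(1) by (simp add: assoc_mult_mat[of _ n n _ n _ n])
  also have "\<dots> = ?d \<cdot>\<^sub>m ?G"
    unfolding adj(3) by (simp add: mult_smult_assoc_mat[of _ n n _ n] left_mult_one_mat[of _ n n])
  finally have eq: "?d \<cdot>\<^sub>m adj_mat ?M = ?d \<cdot>\<^sub>m ?G" .
  show ?thesis
  proof (rule eq_matI)
    fix i j assume "i < dim_row ?G" "j < dim_col ?G"
    hence "i < n" "j < n" by (auto simp: spectral_mat_def)
    thus "adj_mat ?M $$ (i, j) = ?G $$ (i, j)"
      using arg_cong[OF eq, of "\<lambda>A. A $$ (i, j)"] adj(1) d spectral_mat_carrier[of n v]
      by (auto simp: spectral_mat_def)
  qed (use adj(1) in \<open>auto simp: spectral_mat_def\<close>)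
qed

end

text \<open>The determinant of \<open>x I + K\<close> is expanded twice, by principal minors and by
  eigenvalues, and the coefficients of \<open>x ^ (n - k)\<close> agree. This identifies the
  normalising constant of the k-DPP.\<close>

lemma sum_minors_eq_esum:
  fixes n :: nat and v :: "nat \<Rightarrow> real vec"
  assumes v: "\<And>i. i < n \<Longrightarrow> v i \<in> carrier_vec n"
    "\<And>i j. i < n \<Longrightarrow> j < n \<Longrightarrow> v i \<bullet> v j = (if i = j then 1 else 0)"
  shows "(\<Sum>S | S \<subseteq> {0..<n} \<and> card S = k. minor (spectral_mat n v f) S) = esum k f {0..<n}"
proof (cases "k \<le> n")
  \<comment> \<open>For \<open>k > n\<close> the truncated exponent \<open>n - k\<close> would be 0
    and pick out the full set, so this case is treated apart; both sums are empty.\<close>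
  case False
  have empty: "{S. S \<subseteq> {0..<n} \<and> card S = k} = {}"
    using False card_mono[of "{0..<n}"] by fastforce
  show ?thesis unfolding esum_def empty by simp
next
  case True
  let ?K = "spectral_mat n v f" and ?U = "{0..<n}"
  have "(\<Sum>S\<in>Pow ?U. minor ?K S * x ^ (n - card S)) = (\<Sum>S\<in>Pow ?U. (\<Prod>i\<in>S. f i) * x ^ (n - card S))" for x
  proof -
    have "(\<Sum>S\<in>Pow ?U. minor ?K S * x ^ (n - card S)) = (\<Sum>S\<in>Pow ?U. minor ?K S * (\<Prod>i\<in>?U - S. x))"
      by (intro sum.cong refl) (auto simp: card_Diff_subset finite_subset)
    also have "\<dots> = det (mat n n (\<lambda>(i, j). ?K $$ (i, j) + (if i = j then x else 0)))"
      by (rule det_add_diagonal[OF spectral_mat_carrier, symmetric])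
    also have "mat n n (\<lambda>(i, j). ?K $$ (i, j) + (if i = j then x else 0)) = spectral_mat n v (\<lambda>l. x + f l)"
      by (rule spectral_mat_shift[OF v])
    also have "det \<dots> = (\<Prod>l\<in>?U. x + f l)"
      by (rule det_spectral_mat[OF v])
    also have "\<dots> = (\<Sum>S\<in>Pow ?U. (\<Prod>i\<in>S. f i) * x ^ (n - card S))"
      by (simp add: prod_shift_expand)
    finally show ?thesis .
  qed
  hence "(\<Sum>S | S \<in> Pow ?U \<and> n - card S = n - k. minor ?K S) =
      (\<Sum>S | S \<in> Pow ?U \<and> n - card S = n - k. \<Prod>i\<in>S. f i)"
    by (intro sum_powers_eq_imp_coeff_eq) auto
  moreover have "{S. S \<in> Pow ?U \<and> n - card S = n - k} = {S. S \<subseteq> ?U \<and> card S = k}"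
  proof -
    have "n - card S = n - k \<longleftrightarrow> card S = k" if "S \<subseteq> ?U" for S
      using card_mono[OF _ that] True by auto
    thus ?thesis by auto
  qed
  ultimately show ?thesis by (simp add: esum_def)
qed

text \<open>The same comparison of coefficients for the entry \<open>(a, b)\<close> of the adjugate
  of \<open>x I + K\<close>.\<close>

lemma sum_minors_unit_row:
  fixes n :: nat and v :: "nat \<Rightarrow> real vec"
  assumes v: "\<And>i. i < n \<Longrightarrow> v i \<in> carrier_vec n"
    "\<And>i j. i < n \<Longrightarrow> j < n \<Longrightarrow> v i \<bullet> v j = (if i = j then 1 else 0)"
    and f: "\<And>l. l < n \<Longrightarrow> f l > 0" and a: "a < n" and b: "b < n" and k: "1 \<le> k" "k \<le> n"
  shows "(\<Sum>S | S \<subseteq> {0..<n} \<and> card S = k. if b \<in> S then minor (unit_row (spectral_mat n v f) b a) S else 0) =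
     spectral_mat n v (\<lambda>l. esum (k - 1) f ({0..<n} - {l})) $$ (a, b)"
proof -
  let ?K = "spectral_mat n v f" and ?U = "{0..<n}"
  let ?R = "unit_row ?K b a"
  let ?m = "\<lambda>S. if b \<in> S then minor ?R S else 0"
  \<comment> \<open>Pairs of an eigenvector index and a subset of the other indices, so that the
    whole spectral expansion is one sum of powers.\<close>
  let ?J = "Sigma ?U (\<lambda>l. Pow (?U - {l}))"
  let ?g = "\<lambda>(l, T). (\<Prod>i\<in>T. f i) * (v l $ a * v l $ b)"
  have "(\<Sum>S\<in>Pow ?U. ?m S * x ^ (n - card S)) = (\<Sum>p\<in>?J. ?g p * x ^ (n - 1 - card (snd p)))"
    if x: "x > 0" for x
  proof -
    let ?M = "spectral_mat n v (\<lambda>l. x + f l)"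
    have fin: "finite S" if "S \<subseteq> ?U" for S using that by (rule finite_subset) simp
    \<comment> \<open>Row \<open>b\<close> is already a unit vector and must not be shifted, so the
      diagonal perturbation is 0 there. This removes exactly the sets that miss
      \<open>b\<close>.\<close>
    have "(\<Sum>S\<in>Pow ?U. ?m S * x ^ (n - card S)) =
        (\<Sum>S\<in>Pow ?U. minor ?R S * (\<Prod>i\<in>?U - S. if i = b then 0 else x))"
    proof (intro sum.cong refl)
      fix S assume "S \<in> Pow ?U"
      hence S: "S \<subseteq> ?U" by simp
      have "(\<Prod>i\<in>?U - S. if i = b then 0 else x) = (if b \<in> S then x ^ (n - card S) else 0)"
      proof (cases "b \<in> S")
        case True
        hence "(\<Prod>i\<in>?U - S. if i = b then 0 else x) = (\<Prod>i\<in>?U - S. x)"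
          by (intro prod.cong) auto
        thus ?thesis using True S fin[OF S] by (simp add: card_Diff_subset)
      next
        case False
        hence "(\<Prod>i\<in>?U - S. if i = b then 0 else x) = 0"
          using b by (intro prod_zero bexI[of _ b]) auto
        thus ?thesis using False by simp
      qed
      thus "?m S * x ^ (n - card S) = minor ?R S * (\<Prod>i\<in>?U - S. if i = b then 0 else x)"
        by simp
    qed
    also have "\<dots> = det (mat n n (\<lambda>(i, j). ?R $$ (i, j) + (if i = j then if i = b then 0 else x else 0)))"
      by (rule det_add_diagonal[OF unit_row_carrier[OF spectral_mat_carrier], symmetric])
    also have "mat n n (\<lambda>(i, j). ?R $$ (i, j) + (if i = j then if i = b then 0 else x else 0)) = unit_row ?M b a"
    proof (rule eq_matI)
      fix i j assume "i < dim_row (unit_row ?M b a)" "j < dim_col (unit_row ?M b a)"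
      hence ij: "i < n" "j < n" by (auto simp: unit_row_def spectral_mat_def)
      have "?M $$ (i, j) = ?K $$ (i, j) + (if i = j then x else 0)"
        using arg_cong[OF spectral_mat_shift[OF v, of f x], of "\<lambda>A. A $$ (i, j)"] ij by simp
      thus "mat n n (\<lambda>(i, j). ?R $$ (i, j) + (if i = j then if i = b then 0 else x else 0)) $$ (i, j) =
          unit_row ?M b a $$ (i, j)"
        using ij by (simp add: unit_row_index[OF spectral_mat_carrier])
    qed (simp_all add: unit_row_def spectral_mat_def)
    also have "det (unit_row ?M b a) = adj_mat ?M $$ (a, b)"
      by (rule det_unit_row[OF spectral_mat_carrier a b])
    also have "adj_mat ?M = spectral_mat n v (\<lambda>l. \<Prod>m\<in>?U - {l}. x + f m)"
    proof (rule adj_spectral_mat[OF v])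
      show "x + f l \<noteq> 0" if "l < n" for l using f[OF that] x by simp
    qed
    also have "\<dots> $$ (a, b) = (\<Sum>l\<in>?U. (\<Prod>m\<in>?U - {l}. x + f m) * (v l $ a * v l $ b))"
      using a b by (simp add: spectral_mat_def)
    also have "\<dots> = (\<Sum>l\<in>?U. \<Sum>T\<in>Pow (?U - {l}). ?g (l, T) * x ^ (n - 1 - card T))"
    proof (intro sum.cong refl)
      fix l assume l: "l \<in> ?U"
      show "(\<Prod>m\<in>?U - {l}. x + f m) * (v l $ a * v l $ b) =
          (\<Sum>T\<in>Pow (?U - {l}). ?g (l, T) * x ^ (n - 1 - card T))"
        using l by (simp add: prod_shift_expand sum_distrib_right mult.assoc)
           (simp add: mult.left_commute mult.commute)
    qed
    also have "\<dots> = (\<Sum>p\<in>?J. ?g p * x ^ (n - 1 - card (snd p)))"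
      by (subst sum.Sigma) (auto simp: case_prod_beta)
    finally show ?thesis .
  qed
  hence "(\<Sum>S | S \<in> Pow ?U \<and> n - card S = n - k. ?m S) =
      (\<Sum>p | p \<in> ?J \<and> n - 1 - card (snd p) = n - k. ?g p)"
    by (intro sum_powers_eq_imp_coeff_eq) auto
  also have "{p. p \<in> ?J \<and> n - 1 - card (snd p) = n - k} =
      Sigma ?U (\<lambda>l. {T. T \<subseteq> ?U - {l} \<and> card T = k - 1})"
  proof -
    \<comment> \<open>No subtraction truncates here; passing from \<open>n\<close> to
      \<open>n - 1\<close> eigenvalues turns \<open>k\<close> into \<open>k - 1\<close>.\<close>
    have "n - 1 - card T = n - k \<longleftrightarrow> card T = k - 1" if "l < n" "T \<subseteq> ?U - {l}" for l T
    proof -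
      have "card T \<le> n - 1" using card_mono[OF _ that(2)] that(1) by simp
      thus ?thesis using k by linarith
    qed
    moreover have "Suc (k - Suc 0) = k" using k by simp
    ultimately show ?thesis by auto
  qed
  also have "(\<Sum>p\<in>Sigma ?U (\<lambda>l. {T. T \<subseteq> ?U - {l} \<and> card T = k - 1}). ?g p) =
      (\<Sum>l\<in>?U. \<Sum>T | T \<subseteq> ?U - {l} \<and> card T = k - 1. ?g (l, T))"
    by (subst sum.Sigma) (auto simp: case_prod_beta)
  also have "\<dots> = spectral_mat n v (\<lambda>l. esum (k - 1) f (?U - {l})) $$ (a, b)"
    using a b by (simp add: spectral_mat_def esum_def sum_distrib_right)
  finally have eq: "(\<Sum>S | S \<in> Pow ?U \<and> n - card S = n - k. ?m S) = \<dots>" .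
  moreover have "{S. S \<in> Pow ?U \<and> n - card S = n - k} = {S. S \<subseteq> ?U \<and> card S = k}"
  proof -
    have "n - card S = n - k \<longleftrightarrow> card S = k" if "S \<subseteq> ?U" for S
      using card_mono[OF _ that] k(2) by auto
    thus ?thesis by auto
  qed
  ultimately show ?thesis by simp
qed

text \<open>The characteristic polynomial splits with roots \<open>f l\<close>, and since
  \<open>f\<close> is decreasing, sorting the multiset of roots restores the given order.\<close>

lemma eigenvalue_vec_spectral_mat:
  fixes n :: nat and v :: "nat \<Rightarrow> real vec"
  assumes v: "\<And>i. i < n \<Longrightarrow> v i \<in> carrier_vec n"
    "\<And>i j. i < n \<Longrightarrow> j < n \<Longrightarrow> v i \<bullet> v j = (if i = j then 1 else 0)"
    and anti: "\<And>i j. i \<le> j \<Longrightarrow> j < n \<Longrightarrow> f j \<le> f i"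
  shows "eigenvalue_vec (spectral_mat n v f) = vec n f"
proof -
  let ?l = "map f [0..<n]"
  have "char_poly (spectral_mat n v f) = (\<Prod>p\<leftarrow>map (\<lambda>l. [:- f l, 1:]) [0..<n]. p)"
    by (simp add: char_poly_spectral_mat[OF v])
  hence "proots (char_poly (spectral_mat n v f)) = (\<Sum>p\<leftarrow>map (\<lambda>l. [:- f l, 1:]) [0..<n]. proots p)"
    by (simp only:) (rule proots_prod_list, auto)
  also have "\<dots> = (\<Sum>l\<leftarrow>[0..<n]. {#f l#})"
    by (simp add: o_def)
  also have "\<dots> = mset ?l"
    by (simp add: sum_list_singleton_mset)
  \<comment> \<open>The reversal is kept inside \<open>mset\<close> to exhibit an increasing list,
    the form produced by \<open>sorted_list_of_multiset\<close>.\<close>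
  finally have 1: "proots (char_poly (spectral_mat n v f)) = mset (rev ?l)" by simp
  have "sorted (rev ?l)"
    unfolding sorted_rev_iff_nth_mono using anti by simp
  hence "sorted_list_of_multiset (mset (rev ?l)) = rev ?l"
    by (simp add: sorted_sort_id del: mset_rev)
  hence "eigenvalue_vec (spectral_mat n v f) = vec_of_list ?l"
    unfolding eigenvalue_vec_def 1 by (simp del: mset_rev)
  also have "\<dots> = vec n f" by (intro eq_vecI) (auto simp: vec_of_list_index)
  finally show ?thesis .
qed

subsection \<open>Positivity\<close>

lemma det_pos_of_quadratic_form_pos:
  fixes A :: "real mat"
  assumes A: "A \<in> carrier_mat n n"
    and pos: "\<And>x. x \<in> carrier_vec n \<Longrightarrow> x \<noteq> 0\<^sub>v n \<Longrightarrow> x \<bullet> (A *\<^sub>v x) > 0"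
  shows "det A > 0"
proof (rule ccontr)
  assume neg: "\<not> det A > 0"
  \<comment> \<open>On the segment from the identity to \<open>A\<close> all matrices are nonsingular, so the sign of the
    determinant cannot change.\<close>
  define M where "M t = mat n n (\<lambda>(i, j). t * A $$ (i, j) + (1 - t) * (if i = j then 1 else 0))" for t
  have M: "M t \<in> carrier_mat n n" for t by (simp add: M_def)
  have M_eq: "M t = t \<cdot>\<^sub>m A + (1 - t) \<cdot>\<^sub>m 1\<^sub>m n" for t
    using A by (intro eq_matI) (auto simp: M_def)
  have "M 0 = 1\<^sub>m n" "M 1 = A" using A by (auto intro!: eq_matI simp: M_def)
  hence "det (M 0) = 1" "det (M 1) = det A" by simp_all
  moreover have "continuous_on {0..1} (\<lambda>t. det (M t))"
    unfolding M_def det_mat_eq_sum_permutes by (intro continuous_intros)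
  ultimately obtain t where t: "0 \<le> t" "t \<le> 1" "det (M t) = 0"
    using IVT2'[of "\<lambda>t. det (M t)" 1 0 0] neg by auto
  then obtain x where x: "x \<in> carrier_vec n" "x \<noteq> 0\<^sub>v n" "M t *\<^sub>v x = 0\<^sub>v n"
    using det_0_iff_vec_prod_zero[OF M] by blast
  have "x \<bullet> (M t *\<^sub>v x) = t * (x \<bullet> (A *\<^sub>v x)) + (1 - t) * (x \<bullet> x)"
  proof -
    have smult: "(c \<cdot>\<^sub>m B) *\<^sub>v x = c \<cdot>\<^sub>v (B *\<^sub>v x)" if "B \<in> carrier_mat n n" for c B
      using that x(1) by (intro eq_vecI) auto
    have "M t *\<^sub>v x = t \<cdot>\<^sub>v (A *\<^sub>v x) + (1 - t) \<cdot>\<^sub>v x"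
      unfolding M_eq using A x(1) by (simp add: add_mult_distrib_mat_vec[of _ n n] smult)
    thus ?thesis using A x(1) by (simp add: scalar_prod_add_distrib[of _ n])
  qed
  moreover have "x \<bullet> x > 0"
  proof -
    obtain i where "i < n" "x $ i \<noteq> 0"
      using x(1,2) by (metis eq_vecI carrier_vecD index_zero_vec)
    hence "(\<Sum>i = 0..<n. x $ i * x $ i) > 0"
      by (intro sum_pos2[of _ i]) (auto simp flip: power2_eq_square)
    thus ?thesis using x(1) by (simp add: scalar_prod_def)
  qed
  moreover have "x \<bullet> (A *\<^sub>v x) > 0" using x pos by blast
  \<comment> \<open>At \<open>t = 0\<close> only \<open>x \<bullet> x\<close> remains; otherwise the
    first summand is positive and the second nonnegative.\<close>
  ultimately have "x \<bullet> (M t *\<^sub>v x) > 0"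
    using t by (cases "t = 0") (auto intro: add_pos_nonneg)
  thus False using x by simp
qed

text \<open>The quadratic form of the submatrix at \<open>x\<close> is that of \<open>K\<close> at
  the zero-padded vector \<open>?y\<close>, which is nonzero because padding retains every
  coordinate of \<open>x\<close>.\<close>

lemma det_principal_submat_pos:
  assumes pd: "positive_definite n K" and S: "S \<subseteq> {0..<n}"
  shows "det (principal_submat K S) > 0"
proof (rule det_pos_of_quadratic_form_pos)
  let ?C = "sampling_mat n S" and ?P = "principal_submat K S" and ?m = "card S"
  have K: "K \<in> carrier_mat n n" using pd by (simp add: positive_definite_def)
  note C = sampling_mat_carrier[OF S]
  have P_eq: "?P = transpose_mat ?C * K * ?C" using K by (simp add: principal_submat_def)
  show "?P \<in> carrier_mat ?m ?m" using principal_submat_eq[OF K S] by simp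
  fix x :: "real vec" assume x: "x \<in> carrier_vec ?m" "x \<noteq> 0\<^sub>v ?m"
  let ?y = "?C *\<^sub>v x"
  have y: "?y \<in> carrier_vec n" using C x(1) by simp
  have "x \<bullet> (?P *\<^sub>v x) = x \<bullet> (transpose_mat ?C *\<^sub>v (K *\<^sub>v ?y))"
  proof -
    have Ct: "transpose_mat ?C \<in> carrier_mat ?m n" using C by simp
    have "?P *\<^sub>v x = transpose_mat ?C * K *\<^sub>v ?y"
      unfolding P_eq by (rule assoc_mult_mat_vec[OF mult_carrier_mat[OF Ct K] C x(1)])
    thus ?thesis by (simp add: assoc_mult_mat_vec[OF Ct K y])
  qed
  also have "\<dots> = ?y \<bullet> (K *\<^sub>v ?y)"
  proof -
    have Ky: "K *\<^sub>v ?y \<in> carrier_vec n" using K y by simp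
    hence "transpose_mat ?C *\<^sub>v (K *\<^sub>v ?y) \<in> carrier_vec ?m" using C by simp
    hence "x \<bullet> (transpose_mat ?C *\<^sub>v (K *\<^sub>v ?y)) = (transpose_mat ?C *\<^sub>v (K *\<^sub>v ?y)) \<bullet> x"
      by (rule comm_scalar_prod[OF x(1)])
    also have "\<dots> = (K *\<^sub>v ?y) \<bullet> ?y"
      by (rule transpose_vec_mult_scalar[OF C x(1) Ky])
    finally show ?thesis by (simp add: comm_scalar_prod[OF Ky y])
  qed
  finally have eq: "x \<bullet> (?P *\<^sub>v x) = ?y \<bullet> (K *\<^sub>v ?y)" .
  obtain j where j: "j < ?m" "x $ j \<noteq> 0"
    using x by (metis eq_vecI carrier_vecD index_zero_vec)
  have bij: "bij_betw (pick S) {0..<?m} S"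
    using S by (intro bij_betw_pick) (rule finite_subset, auto)
  have pn: "pick S j < n" using S j(1) pick_in_set[of j S] by force
  have "?y $ pick S j = (\<Sum>i = 0..<?m. ?C $$ (pick S j, i) * x $ i)"
    using C x(1) pn by (simp add: scalar_prod_def)
  also have "\<dots> = (\<Sum>i = 0..<?m. if i = j then x $ i else 0)"
  proof (rule sum.cong[OF refl])
    fix i assume i: "i \<in> {0..<?m}"
    have "pick S j = pick S i \<longleftrightarrow> i = j"
      using bij i j(1) by (auto simp: bij_betw_def inj_on_def)
    thus "?C $$ (pick S j, i) * x $ i = (if i = j then x $ i else 0)"
      using i by (simp add: sampling_mat_index[OF S pn])
  qed
  finally have "?y $ pick S j = x $ j" using j(1) by simp
  hence "?y \<noteq> 0\<^sub>v n" using j(2) pn by auto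
  thus "x \<bullet> (?P *\<^sub>v x) > 0"
    using pd y eq by (simp add: positive_definite_def)
qed

text \<open>The quadratic form at the unit eigenvector \<open>v l\<close> equals
  \<open>f l\<close>.\<close>

lemma positive_definite_spectral_mat_eigenvalues:
  fixes n :: nat and v :: "nat \<Rightarrow> real vec"
  assumes v: "\<And>i. i < n \<Longrightarrow> v i \<in> carrier_vec n"
    "\<And>i j. i < n \<Longrightarrow> j < n \<Longrightarrow> v i \<bullet> v j = (if i = j then 1 else 0)"
    and pd: "positive_definite n (spectral_mat n v f)" and l: "l < n"
  shows "f l > 0"
proof -
  let ?K = "spectral_mat n v f"
  have "?K *\<^sub>v v l = f l \<cdot>\<^sub>v v l"
  proof (rule eq_vecI)
    fix i assume "i < dim_vec (f l \<cdot>\<^sub>v v l)"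
    hence i: "i < n" using v(1)[OF l] by simp
    have "(?K *\<^sub>v v l) $ i = (\<Sum>j = 0..<n. (\<Sum>m = 0..<n. f m * (v m $ i * v m $ j)) * v l $ j)"
      using i v(1)[OF l] by (simp add: spectral_mat_def scalar_prod_def)
    also have "\<dots> = (\<Sum>j = 0..<n. \<Sum>m = 0..<n. f m * v m $ i * (v m $ j * v l $ j))"
      by (simp add: sum_distrib_right mult.assoc)
    also have "\<dots> = (\<Sum>m = 0..<n. \<Sum>j = 0..<n. f m * v m $ i * (v m $ j * v l $ j))"
      by (rule sum.swap)
    also have "\<dots> = (\<Sum>m = 0..<n. f m * v m $ i * (v m \<bullet> v l))"
      using v(1)[OF l] by (simp add: scalar_prod_def sum_distrib_left)
    also have "\<dots> = (\<Sum>m = 0..<n. if m = l then f m * v m $ i else 0)"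
      using l by (intro sum.cong refl) (simp add: v(2))
    finally show "(?K *\<^sub>v v l) $ i = (f l \<cdot>\<^sub>v v l) $ i"
      using l i v(1)[OF l] by simp
  qed (use v(1)[OF l] in \<open>simp add: spectral_mat_def\<close>)
  hence "v l \<bullet> (?K *\<^sub>v v l) = f l"
    using v(2)[OF l l] v(1)[OF l] by simp
  moreover have "v l \<noteq> 0\<^sub>v n"
    using v(2)[OF l l] by auto
  ultimately show ?thesis
    using pd v(1)[OF l] by (force simp: positive_definite_def)
qed

subsection \<open>The expectation\<close>

text \<open>\<open>embed_pmf\<close> has the prescribed weights once they are nonnegative with total
  1. Finite support then reduces the integral to a sum.\<close>

lemma expectation_embed_pmf_finite:
  fixes w g :: "'a \<Rightarrow> real"
  assumes A: "finite A" and nonneg: "\<And>x. x \<in> A \<Longrightarrow> w x \<ge> 0" and sum1: "(\<Sum>x\<in>A. w x) = 1"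
  shows "measure_pmf.expectation (embed_pmf (\<lambda>x. if x \<in> A then w x else 0)) g = (\<Sum>x\<in>A. w x * g x)"
proof -
  let ?f = "\<lambda>x. if x \<in> A then w x else 0"
  have f0: "0 \<le> ?f x" for x using nonneg by simp
  have "(\<integral>\<^sup>+x. ennreal (?f x) \<partial>count_space UNIV) = (\<Sum>x\<in>A. ennreal (?f x))"
    using A by (intro nn_integral_count_space') auto
  also have "\<dots> = ennreal (\<Sum>x\<in>A. ?f x)" by (rule sum_ennreal) (rule f0)
  also have "\<dots> = 1" using sum1 by simp
  finally have f1: "(\<integral>\<^sup>+x. ennreal (?f x) \<partial>count_space UNIV) = 1" .
  have "measure_pmf.expectation (embed_pmf ?f) g = (\<Sum>x\<in>A. g x * pmf (embed_pmf ?f) x)"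
    using A set_embed_pmf[OF f0 f1] by (intro integral_measure_pmf_real) (auto split: if_splits)
  thus ?thesis by (simp add: pmf_embed_pmf[OF f0 f1] mult.commute)
qed

theorem corollary1:
  fixes n k :: nat and K :: "real mat" and lam :: "real vec" and v :: "nat \<Rightarrow> real vec"
  assumes "positive_definite n K"
    and "lam \<in> carrier_vec n"
    and "\<And>i j. i \<le> j \<Longrightarrow> j < n \<Longrightarrow> lam $ j \<le> lam $ i"
    and "\<And>i. i < n \<Longrightarrow> v i \<in> carrier_vec n"
    and "\<And>i j. i < n \<Longrightarrow> j < n \<Longrightarrow> v i \<bullet> v j = (if i = j then 1 else 0)"
    and "K = mat_sum n n (\<lambda>l. lam $ l \<cdot>\<^sub>m outer_prod (v l) (v l)) {0..<n}"
    and "1 \<le> k" and "k \<le> n"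
  shows "mat_expectation n n (kDPP k K)
           (\<lambda>S. sampling_mat n S * the (mat_inverse (principal_submat K S))
                  * transpose_mat (sampling_mat n S)) =
         mat_sum n n
           (\<lambda>l. (1 / (lam $ l + elem_sym k (remove_entry l lam) / elem_sym (k - 1) (remove_entry l lam)))
                  \<cdot>\<^sub>m outer_prod (v l) (v l)) {0..<n}"
proof -
  let ?U = "{0..<n}" and ?f = "\<lambda>l. lam $ l"
  let ?A = "{S. S \<subseteq> ?U \<and> card S = k}"
  let ?N = "\<lambda>S. sampling_mat n S * the (mat_inverse (principal_submat K S)) * transpose_mat (sampling_mat n S)"
  let ?e = "esum k ?f ?U" and ?d = "\<lambda>S. det (principal_submat K S)"
  let ?c = "\<lambda>l. 1 / (lam $ l + elem_sym k (remove_entry l lam) / elem_sym (k - 1) (remove_entry l lam))"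
  note v = assms(4,5)
  have K: "K \<in> carrier_mat n n" using assms(1) by (simp add: positive_definite_def)
  have Ks: "K = spectral_mat n v ?f" using assms(6) mat_sum_outer_prod[OF v(1)] by simp
  have dim: "dim_vec lam = n" using assms(2) by simp
  have lam_pos: "lam $ l > 0" if "l < n" for l
    using positive_definite_spectral_mat_eigenvalues[OF v _ that] assms(1) Ks by simp
  have "eigenvalue_vec K = vec n ?f"
    unfolding Ks by (rule eigenvalue_vec_spectral_mat[OF v assms(3)])
  also have "\<dots> = lam" using dim by (intro eq_vecI) auto
  finally have e: "elem_sym_mat k K = ?e"
    by (simp add: elem_sym_mat_def elem_sym_eq_esum dim)
  have e_pos: "?e > 0" using assms(8) lam_pos by (intro esum_pos) auto
  \<comment> \<open>Divide numerator and denominator by \<open>esum (k - 1)\<close> over the other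
    indices, which is positive since \<open>k - 1 \<le> n - 1\<close>, after splitting
    \<open>?e\<close> by the recursion.\<close>
  have coeff: "esum (k - 1) ?f (?U - {l}) / ?e = ?c l" if l: "l < n" for l
  proof -
    have "card (?U - {l}) = n - 1" using l by simp
    hence "esum (k - 1) ?f (?U - {l}) > 0"
      using assms(8) lam_pos by (intro esum_pos) auto
    moreover have "?e = lam $ l * esum (k - 1) ?f (?U - {l}) + esum k ?f (?U - {l})"
      using esum_insert[of "?U - {l}" l "k - 1" ?f] assms(7) l by (simp add: insert_absorb)
    ultimately show ?thesis
      using l e_pos by (simp add: elem_sym_remove_entry dim field_simps)
  qed
  have kDPP: "kDPP k K = embed_pmf (\<lambda>S. if S \<in> ?A then ?d S / ?e else 0)"
    unfolding kDPP_def e using K by simp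
  have d_pos: "?d S > 0" if "S \<in> ?A" for S
    using det_principal_submat_pos[OF assms(1)] that by blast
  have "(\<Sum>S\<in>?A. ?d S) = (\<Sum>S\<in>?A. minor (spectral_mat n v ?f) S)"
    using det_principal_submat[OF K] Ks by (intro sum.cong) auto
  hence "(\<Sum>S\<in>?A. ?d S) = ?e" using sum_minors_eq_esum[OF v] by simp
  \<comment> \<open>With positivity of the minors, this shows that the k-DPP weights form a genuine
    distribution.\<close>
  hence sum1: "(\<Sum>S\<in>?A. ?d S / ?e) = 1" using e_pos by (simp flip: sum_divide_distrib)
  have "measure_pmf.expectation (kDPP k K) (\<lambda>S. ?N S $$ (a, b)) = spectral_mat n v ?c $$ (a, b)"
    if a: "a < n" and b: "b < n" for a b
  proof -
    have "measure_pmf.expectation (kDPP k K) (\<lambda>S. ?N S $$ (a, b)) = (\<Sum>S\<in>?A. ?d S / ?e * ?N S $$ (a, b))"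
      unfolding kDPP using d_pos e_pos sum1
      by (intro expectation_embed_pmf_finite) (auto intro: less_imp_le)
    also have "\<dots> = (\<Sum>S\<in>?A. ?d S * ?N S $$ (a, b)) / ?e"
      by (simp add: sum_divide_distrib)
    \<comment> \<open>The weight of each set cancels the determinant in the denominator of its
      inverse, leaving minors only.\<close>
    also have "(\<Sum>S\<in>?A. ?d S * ?N S $$ (a, b)) =
        (\<Sum>S\<in>?A. if b \<in> S then minor (unit_row (spectral_mat n v ?f) b a) S else 0)"
    proof (rule sum.cong[OF refl])
      fix S assume S: "S \<in> ?A"
      show "?d S * ?N S $$ (a, b) = (if b \<in> S then minor (unit_row (spectral_mat n v ?f) b a) S else 0)"
        using padded_inverse_index[OF K _ a b, of S] d_pos[OF S] S Ks by auto
    qed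
    also have "\<dots> = spectral_mat n v (\<lambda>l. esum (k - 1) ?f (?U - {l})) $$ (a, b)"
      by (rule sum_minors_unit_row[OF v lam_pos a b assms(7,8)])
    also have "\<dots> / ?e = (\<Sum>l = 0..<n. esum (k - 1) ?f (?U - {l}) / ?e * (v l $ a * v l $ b))"
      using a b by (simp add: spectral_mat_def sum_divide_distrib)
    also have "\<dots> = (\<Sum>l = 0..<n. ?c l * (v l $ a * v l $ b))"
      by (rule sum.cong[OF refl]) (simp only: coeff atLeastLessThan_iff)
    also have "\<dots> = spectral_mat n v ?c $$ (a, b)"
      using a b by (simp add: spectral_mat_def)
    finally show ?thesis .
  qed
  hence "mat_expectation n n (kDPP k K) ?N = spectral_mat n v ?c"
    by (intro eq_matI) (auto simp: mat_expectation_def spectral_mat_def)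
  thus ?thesis using mat_sum_outer_prod[OF v(1)] by simp
qed

end
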